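(* If $\mathcal{G}$ is an $r$-regular finite simple graph with vertices $v_1,\dots,v_p$, then both $LE_{CN}(\mathcal{G})$ and $LE^+_{CN}(\mathcal{G})$ are at most \[ \sum_{i=1}^{p}\sqrt{\sum_{k=1}^{p}|N(v_i)\cap N(v_k)|^2}. \]
   Context: $N(v)$ denotes the open neighbourhood of $v$. $\mathrm{CN}(\mathcal{G})$ has $(i,j)$-entry $|N(v_i)\cap N(v_j)|$ for $i\neq j$ and $0$ on the diagonal; $\mathrm{CNRS}(\mathcal{G})$ is the diagonal matrix of its row sums; $\mathrm{CNL}=\mathrm{CNRS}-\mathrm{CN}$, $\mathrm{CNSL}=\mathrm{CNRS}+\mathrm{CN}$; $LE_{CN}(\mathcal{G})=\sum_\nu|\nu-tr(\mathrm{CNRS}(\mathcal{G}))/p|$ over eigenvalues of $\mathrm{CNL}(\mathcal{G})$ with multiplicity, and $LE^+_{CN}(\mathcal{G})$ likewise with $\mathrm{CNSL}(\mathcal{G})$. *)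

theory Defs
  imports "Graph_Theory.Digraph" "Jordan_Normal_Form.Spectral_Radius"
begin

(* A finite simple graph is a structure G with "graph G" from Graph_Theory.Digraph: finite,
   loop-free, without parallel arcs and symmetric, so that every undirected edge {u, v} is the
   pair of arcs (u, v), (v, u).  Its vertices v_1, ..., v_p are given by a distinct list vs with
   set vs = verts G; the vertex v_i is vs ! (i - 1), and p = length vs. *)

definition nbhd :: "('a, 'b) pre_digraph \<Rightarrow> 'a \<Rightarrow> 'a set" where
  "nbhd G v = {w. v \<rightarrow>\<^bsub>G\<^esub> w}"

(* Each edge at v contributes exactly one arc with tail v, so out_degree is the degree. *)
definition regular_graph :: "nat \<Rightarrow> ('a, 'b) pre_digraph \<Rightarrow> bool" where
  "regular_graph r G \<longleftrightarrow> graph G \<and> (\<forall>v\<in>verts G. out_degree G v = r)"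

lemma (in graph) out_degree_eq_card_nbhd: "out_degree G v = card (nbhd G v)"
proof -
  have "nbhd G v = head G ` out_arcs G v"
    by (auto simp: nbhd_def arcs_ends_conv out_arcs_def)
  moreover have "inj_on (head G) (out_arcs G v)"
    using no_multi_arcs by (auto simp: inj_on_def out_arcs_def arc_to_ends_def)
  ultimately show ?thesis
    by (simp add: out_degree_def card_image)
qed

definition CN :: "('a, 'b) pre_digraph \<Rightarrow> 'a list \<Rightarrow> real mat" where
  "CN G vs = mat (length vs) (length vs)
     (\<lambda>(i, j). if i = j then 0 else real (card (nbhd G (vs ! i) \<inter> nbhd G (vs ! j))))"

definition CNRS :: "('a, 'b) pre_digraph \<Rightarrow> 'a list \<Rightarrow> real mat" where
  "CNRS G vs = mat_diag (length vs) (\<lambda>i. \<Sum>j<length vs. CN G vs $$ (i, j))"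

definition CNL :: "('a, 'b) pre_digraph \<Rightarrow> 'a list \<Rightarrow> real mat" where
  "CNL G vs = CNRS G vs - CN G vs"

definition CNSL :: "('a, 'b) pre_digraph \<Rightarrow> 'a list \<Rightarrow> real mat" where
  "CNSL G vs = CNRS G vs + CN G vs"

definition mat_trace :: "'a :: comm_monoid_add mat \<Rightarrow> 'a" where
  "mat_trace A = (\<Sum>i<dim_row A. A $$ (i, i))"

(* The sum of |\<nu> - c| over all complex eigenvalues \<nu> of A, each counted with its algebraic
   multiplicity. For the symmetric matrices CNL and CNSL all eigenvalues are real. *)
definition eigenvalue_deviation :: "real mat \<Rightarrow> real \<Rightarrow> real" where
  "eigenvalue_deviation A c =
     (let B = map_mat complex_of_real A
      in \<Sum>\<nu>\<in>spectrum B. real (Polynomial.order \<nu> (char_poly B)) * cmod (\<nu> - complex_of_real c))"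

definition LE_CN :: "('a, 'b) pre_digraph \<Rightarrow> 'a list \<Rightarrow> real" where
  "LE_CN G vs = eigenvalue_deviation (CNL G vs) (mat_trace (CNRS G vs) / real (length vs))"

definition LE_CN_plus :: "('a, 'b) pre_digraph \<Rightarrow> 'a list \<Rightarrow> real" where
  "LE_CN_plus G vs = eigenvalue_deviation (CNSL G vs) (mat_trace (CNRS G vs) / real (length vs))"

end

theory Submission
  imports Defs "HOL-Analysis.L2_Norm"
begin

text \<open>
  In an \<open>r\<close>-regular graph \<open>CNRS = d I\<close> with \<open>d = r (r - 1)\<close>, so both energies are sums of
  absolute eigenvalues of \<open>\<plusminus>CN\<close>. For any complex matrix \<open>M\<close>, unitary triangularisation
  \<open>U\<^sup>* M U = T\<close> gives
  \<open>\<Sum>\<^sub>k \<bar>T\<^sub>k\<^sub>k\<bar> \<le> \<Sum>\<^sub>j \<Sum>\<^sub>k \<bar>U\<^sub>j\<^sub>k\<bar> \<bar>(U\<^sup>* M)\<^sub>k\<^sub>j\<bar>\<close>; by Cauchy-Schwarz the inner sum is at most the norm of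
  the \<open>j\<close>-th column of \<open>U\<^sup>* M\<close>, which is that of \<open>M\<close>, since the rows of \<open>U\<close> are unit vectors.
  The diagonal entries \<open>\<bar>N(v\<^sub>i)\<bar>\<close>, which \<open>CN\<close> lacks, only enlarge the right-hand side.
\<close>

section \<open>Conjugate transposes\<close>

lemma mat_adjoint_dim [simp]:
  "dim_row (mat_adjoint A) = dim_col A" "dim_col (mat_adjoint A) = dim_row A"
  by (auto simp: mat_adjoint_def)

lemma mat_adjoint_carrier [simp]: "mat_adjoint A \<in> carrier_mat m n \<longleftrightarrow> A \<in> carrier_mat n m"
  unfolding carrier_mat_def by auto

lemma mat_adjoint_index [simp]:
  assumes "i < dim_col A" "j < dim_row A"
  shows "mat_adjoint A $$ (i, j) = conjugate (A $$ (j, i))"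
  using assms by (simp add: mat_adjoint_def mat_of_rows_index)

lemma mat_adjoint_mult:
  fixes A B :: "'a :: conjugatable_field mat"
  assumes "A \<in> carrier_mat l m" "B \<in> carrier_mat m n"
  shows "mat_adjoint (A * B) = mat_adjoint B * mat_adjoint A"
proof (rule eq_matI)
  fix i j assume "i < dim_row (mat_adjoint B * mat_adjoint A)" "j < dim_col (mat_adjoint B * mat_adjoint A)"
  then have ij: "i < n" "j < l" using assms by auto
  have "mat_adjoint (A * B) $$ (i, j) = conjugate (\<Sum>k<m. A $$ (j, k) * B $$ (k, i))"
    using assms ij by (simp add: scalar_prod_def atLeast0LessThan)
  also have "\<dots> = (\<Sum>k<m. conjugate (B $$ (k, i)) * conjugate (A $$ (j, k)))"
    by (simp add: sum_conjugate conjugate_dist_mul mult.commute)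
  also have "\<dots> = (mat_adjoint B * mat_adjoint A) $$ (i, j)"
    using assms ij by (simp add: scalar_prod_def atLeast0LessThan)
  finally show "mat_adjoint (A * B) $$ (i, j) = (mat_adjoint B * mat_adjoint A) $$ (i, j)" .
qed (use assms in auto)

lemma mat_adjoint_adjoint [simp]: "mat_adjoint (mat_adjoint A) = A"
  by (intro eq_matI) auto

lemma mat_adjoint_four_block:
  assumes "A \<in> carrier_mat k m" "B \<in> carrier_mat k n" "C \<in> carrier_mat l m" "D \<in> carrier_mat l n"
  shows "mat_adjoint (four_block_mat A B C D) =
    four_block_mat (mat_adjoint A) (mat_adjoint C) (mat_adjoint B) (mat_adjoint D)"
    (is "?L = ?R")
proof (rule eq_matI)
  fix i j assume "i < dim_row ?R" "j < dim_col ?R"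
  then show "?L $$ (i, j) = ?R $$ (i, j)"
    using assms by (cases "i < m"; cases "j < k") (simp_all add: carrier_matD)
qed (use assms in simp_all)

lemma mat_adjoint_one [simp]: "mat_adjoint (1\<^sub>m n :: complex mat) = 1\<^sub>m n"
  by (intro eq_matI) auto

lemma mat_adjoint_zero [simp]: "mat_adjoint (0\<^sub>m m n :: 'a :: conjugatable_field mat) = 0\<^sub>m n m"
  by (intro eq_matI) auto

text \<open>The diagonal of the Gram matrix holds the squared norms of the columns. Identities
  between Gram matrices thus become statements about column norms.\<close>

lemma mat_adjoint_mult_self_diag:
  assumes "X \<in> carrier_mat m n" "j < n"
  shows "(mat_adjoint X * X) $$ (j, j) = complex_of_real (\<Sum>k<m. (cmod (X $$ (k, j)))\<^sup>2)"
proof -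
  have "(mat_adjoint X * X) $$ (j, j) = (\<Sum>k<m. cnj (X $$ (k, j)) * X $$ (k, j))"
    using assms by (simp add: scalar_prod_def atLeast0LessThan)
  also have "\<dots> = (\<Sum>k<m. complex_of_real ((cmod (X $$ (k, j)))\<^sup>2))"
    by (simp only: complex_norm_square mult.commute)
  finally show ?thesis by (simp only: of_real_sum)
qed

section \<open>Unitary triangularisation\<close>

text \<open>Complete \<open>v\<close> to a basis, orthogonalise it by Gram-Schmidt, which keeps the
  first vector, and normalise; the results are the columns of \<open>W\<close>. The factor
  \<open>c\<close> is the reciprocal of the norm of \<open>v\<close>.\<close>

lemma unitary_first_col:
  fixes v :: "complex vec"
  assumes v: "v \<in> carrier_vec n" and v0: "v \<noteq> 0\<^sub>v n"
  obtains W c where "W \<in> carrier_mat n n" "mat_adjoint W * W = 1\<^sub>m n" "col W 0 = c \<cdot>\<^sub>v v"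
proof -
  interpret cof_vec_space n "TYPE(complex)" .
  define b where "b = basis_completion v"
  define ws where "ws = gram_schmidt n b"
  from basis_completion[OF v v0, folded b_def]
  have dist_b: "distinct b" and indep: "\<not> lin_dep (set b)" and b: "set b \<subseteq> carrier_vec n"
    and hdb: "hd b = v" and len_b: "length b = n" by auto
  have n: "n \<noteq> 0" using v v0 by auto
  from hdb len_b n obtain vs where bv: "b = v # vs" by (cases b) auto
  from gram_schmidt_result[OF b dist_b indep refl, folded ws_def]
  have ws: "set ws \<subseteq> carrier_vec n" "corthogonal ws" "length ws = n"
    by (auto simp: len_b)
  from gram_schmidt_hd[OF v, of vs, folded bv] have "hd ws = v" unfolding ws_def .
  then have ws0: "ws ! 0 = v" using ws(3) n by (cases ws) auto
  have wsc: "ws ! i \<in> carrier_vec n" if "i < n" for i using ws that by auto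
  \<comment> \<open>Gram-Schmidt yields orthogonal vectors that need not have length 1;
    \<open>q i\<close> is the squared norm by which the i-th one is normalised.\<close>
  define q where "q i = (\<Sum>k<n. (cmod (ws ! i $ k))\<^sup>2)" for i
  \<comment> \<open>The indices are reversed because \<open>\<bullet>c\<close> conjugates its second
    argument, whereas entry (i, j) of \<open>mat_adjoint W * W\<close> conjugates the i-th
    vector.\<close>
  have sp: "ws ! j \<bullet>c ws ! i = (if i = j then complex_of_real (q i) else 0)" if "i < n" "j < n" for i j
  proof (cases "i = j")
    case True
    then show ?thesis using wsc[OF that(1)]
      by (auto simp: q_def scalar_prod_def complex_norm_square atLeast0LessThan
          intro!: sum.cong simp del: of_real_power)
  next
    case False
    then show ?thesis using corthogonalD[OF ws(2), of j i] that ws(3) by auto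
  qed
  \<comment> \<open>\<open>corthogonal\<close> includes that no vector is orthogonal to itself, so
    \<open>q i\<close> cannot vanish.\<close>
  have qpos: "q i > 0" if "i < n" for i
  proof -
    have "q i \<noteq> 0" using corthogonalD[OF ws(2), of i i] sp[OF that that] that ws(3) by auto
    moreover have "q i \<ge> 0" by (auto simp: q_def intro: sum_nonneg)
    ultimately show ?thesis by simp
  qed
  define W where "W = mat n n (\<lambda>(k, i). ws ! i $ k / complex_of_real (sqrt (q i)))"
  have W: "W \<in> carrier_mat n n" by (simp add: W_def)
  moreover have "mat_adjoint W * W = 1\<^sub>m n"
  proof (rule eq_matI)
    fix i j assume "i < dim_row (1\<^sub>m n :: complex mat)" "j < dim_col (1\<^sub>m n :: complex mat)"
    then have ij: "i < n" "j < n" by auto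
    have "(mat_adjoint W * W) $$ (i, j) =
        (\<Sum>k<n. cnj (ws ! i $ k) / complex_of_real (sqrt (q i)) * (ws ! j $ k / complex_of_real (sqrt (q j))))"
      using ij W by (simp add: scalar_prod_def atLeast0LessThan W_def)
    also have "\<dots> = (\<Sum>k<n. ws ! j $ k * cnj (ws ! i $ k)) / complex_of_real (sqrt (q i) * sqrt (q j))"
      by (simp add: sum_divide_distrib mult.commute)
    also have "(\<Sum>k<n. ws ! j $ k * cnj (ws ! i $ k)) = ws ! j \<bullet>c ws ! i"
      using wsc[OF ij(1)] by (simp add: scalar_prod_def atLeast0LessThan)
    also have "\<dots> / complex_of_real (sqrt (q i) * sqrt (q j)) = (if i = j then 1 else 0)"
      proof (cases "i = j")
      case True
      then have "sqrt (q i) * sqrt (q j) = q i" using qpos[OF ij(1)] by simp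
      then show ?thesis using True qpos[OF ij(1)] sp[OF ij] by simp
    qed (simp only: sp[OF ij], simp)
    finally show "(mat_adjoint W * W) $$ (i, j) = 1\<^sub>m n $$ (i, j)" using ij by simp
  qed (use W in auto)
  moreover have "col W 0 = (1 / complex_of_real (sqrt (q 0))) \<cdot>\<^sub>v v"
    using n v by (intro eq_vecI) (auto simp: W_def ws0)
  ultimately show thesis by (rule that)
qed

text \<open>Deflation, by induction on \<open>es\<close>: a unitary \<open>W\<close> whose first
  column is an eigenvector for \<open>e\<close> turns \<open>A\<close> into a block upper triangular
  matrix with corner \<open>e\<close>, and the induction hypothesis treats the remaining block,
  whose characteristic polynomial has the roots \<open>es\<close>. Of the triangular form only its
  diagonal is recorded; this is what links the eigenvalues to matrix entries.\<close>

theorem unitary_schur: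
  fixes A :: "complex mat"
  assumes "A \<in> carrier_mat n n" and "char_poly A = (\<Prod>e\<leftarrow>es. [:- e, 1:])"
  shows "\<exists>U \<in> carrier_mat n n. mat_adjoint U * U = 1\<^sub>m n \<and> diag_mat (mat_adjoint U * A * U) = es"
  using assms
proof (induction es arbitrary: n A)
  case Nil
  then have "n = 0" using degree_monic_char_poly[of A n] by auto
  with Nil show ?case by (intro bexI[of _ "1\<^sub>m n"]) (auto simp: diag_mat_def)
next
  case (Cons e es)
  note A = Cons.prems(1)
  have "eigenvalue A e"
    unfolding eigenvalue_root_char_poly[OF A] Cons.prems(2) by simp
  then obtain v where v: "v \<in> carrier_vec n" "v \<noteq> 0\<^sub>v n" and Av: "A *\<^sub>v v = e \<cdot>\<^sub>v v"
    using A by (auto simp: eigenvalue_def eigenvector_def)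
  obtain W c where W: "W \<in> carrier_mat n n" and WW: "mat_adjoint W * W = 1\<^sub>m n"
    and W0: "col W 0 = c \<cdot>\<^sub>v v"
    using unitary_first_col[OF v] .
  define W' where "W' = mat_adjoint W"
  have W': "W' \<in> carrier_mat n n" using W by (simp add: W'_def)
  have W'W: "W' * W = 1\<^sub>m n" using WW by (simp add: W'_def)
  have WW': "W * W' = 1\<^sub>m n" by (rule mat_mult_left_right_inverse[OF W' W W'W])
  from v obtain m where n: "n = Suc m" by (cases n) auto
  define A' where "A' = W' * A * W"
  have A': "A' \<in> carrier_mat n n" using A W W' by (simp add: A'_def)
  have "similar_mat_wit A' A W' W"
    by (rule similar_mat_witI[of _ _ n]) (use A A' W W' W'W WW' in \<open>auto simp: A'_def\<close>)
  then have "similar_mat A' A" unfolding similar_mat_def by blast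
  from char_poly_similar[OF this] Cons.prems(2)
  have cp: "char_poly A' = [:- e, 1:] * (\<Prod>e\<leftarrow>es. [:- e, 1:])" by simp
  have w: "col W 0 \<in> carrier_vec n" using W n by (intro col_carrier_vec) auto
  \<comment> \<open>The first column of \<open>W\<close> is an eigenvector, so the first column of
    \<open>W' * A * W\<close> is \<open>e\<close> times that of \<open>W' * W\<close>, a unit
    vector. This produces the zeros below the corner.\<close>
  have "col A' 0 = W' *\<^sub>v (A *\<^sub>v col W 0)"
    unfolding A'_def using A W W' n
    by (subst col_mult2[of _ n n _ n]) (auto intro!: assoc_mult_mat_vec[of _ n n _ n] col_carrier_vec)
  also have "A *\<^sub>v col W 0 = e \<cdot>\<^sub>v col W 0"
    using A v Av by (simp add: W0 mult_mat_vec smult_smult_assoc mult.commute)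
  also have "W' *\<^sub>v (e \<cdot>\<^sub>v col W 0) = e \<cdot>\<^sub>v col (W' * W) 0"
    using w n mult_mat_vec[OF W' w] col_mult2[OF W' W, of 0] by simp
  finally have col0: "col A' 0 = e \<cdot>\<^sub>v col (1\<^sub>m n) 0" by (simp only: W'W)
  have A'0: "A' $$ (i, 0) = (if i = 0 then e else 0)" if "i < n" for i
    using arg_cong[OF col0, of "\<lambda>x. x $ i"] A' that n by auto
  define A2 where "A2 = mat 1 m (\<lambda>(i, j). A' $$ (i, Suc j))"
  define A3 where "A3 = mat m m (\<lambda>(i, j). A' $$ (Suc i, Suc j))"
  define A1 where "A1 = mat 1 1 (\<lambda>_. e)"
  have A1: "A1 \<in> carrier_mat 1 1" and A2: "A2 \<in> carrier_mat 1 m" and A3: "A3 \<in> carrier_mat m m"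
    by (auto simp: A1_def A2_def A3_def)
  have diagA1: "diag_mat A1 = [e]" by (simp add: A1_def diag_mat_def)
  have block: "A' = four_block_mat A1 A2 (0\<^sub>m m 1) A3"
    using A' n A'0 by (intro eq_matI) (auto simp: A1_def A2_def A3_def)
  \<comment> \<open>The characteristic polynomial of a block triangular matrix is the product over
    its diagonal blocks; cancelling the factor of \<open>e\<close> leaves the product over
    \<open>es\<close> required by the induction hypothesis.\<close>
  have "char_poly A' = char_poly A1 * char_poly A3"
    unfolding block by (rule char_poly_four_block_zeros_col[OF A1 A2 A3])
  also have "char_poly A1 = [:- e, 1:]"
    by (simp add: A1_def char_poly_defs det_def sign_def)
  finally have "char_poly A3 = (\<Prod>e\<leftarrow>es. [:- e, 1:])"
    using cp by (metis mult_cancel_left pCons_eq_0_iff zero_neq_one)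
  from Cons.IH[OF A3 this] obtain U where U: "U \<in> carrier_mat m m"
    and UU: "mat_adjoint U * U = 1\<^sub>m m" and diag: "diag_mat (mat_adjoint U * A3 * U) = es" by blast
  define U' where "U' = mat_adjoint U"
  have U': "U' \<in> carrier_mat m m" using U by (simp add: U'_def)
  \<comment> \<open>\<open>F\<close> extends \<open>U\<close> by a 1 in the corner: it is again
    unitary, and conjugation by it keeps the corner \<open>e\<close> while turning \<open>A3\<close>
    into \<open>U' * A3 * U\<close>. Hence \<open>W * F\<close> is the required unitary
    matrix.\<close>
  define F where "F = four_block_mat (1\<^sub>m 1) (0\<^sub>m 1 m) (0\<^sub>m m 1) U"
  define F' where "F' = four_block_mat (1\<^sub>m 1) (0\<^sub>m 1 m) (0\<^sub>m m 1) U'"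
  have F: "F \<in> carrier_mat n n" and F': "F' \<in> carrier_mat n n"
    using U U' n by (auto simp: F_def F'_def)
  have adjF: "mat_adjoint F = F'"
    unfolding F_def F'_def U'_def using U
    by (subst mat_adjoint_four_block[of _ 1 1 _ m _ m]) auto
  have F'F: "F' * F = 1\<^sub>m n"
    unfolding F_def F'_def using U U' UU n
    by (subst mult_four_block_mat[of _ 1 1 _ m _ m _ _ 1 _ m]) (auto simp: U'_def)
  have FAF: "F' * A' * F = four_block_mat A1 (A2 * U) (0\<^sub>m m 1) (U' * A3 * U)"
    unfolding F_def F'_def block using U U' A1 A2 A3
    by (subst mult_four_block_mat[of _ 1 1 _ m _ m _ _ 1 _ m]; auto)
       (subst mult_four_block_mat[of _ 1 1 _ m _ m _ _ 1 _ m]; auto)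
  have adjWF: "mat_adjoint (W * F) = F' * W'"
    using mat_adjoint_mult[OF W F] by (simp add: adjF W'_def)
  have "mat_adjoint (W * F) * (W * F) = F' * (W' * W) * F"
    unfolding adjWF using F F' W W' by (simp add: assoc_mult_mat[of _ n n _ n _ n])
  then have 1: "mat_adjoint (W * F) * (W * F) = 1\<^sub>m n"
    using F F' by (simp add: W'W F'F)
  have "mat_adjoint (W * F) * A * (W * F) = F' * A' * F"
    unfolding adjWF A'_def using F F' W W' A by (simp add: assoc_mult_mat[of _ n n _ n _ n])
  then have 2: "diag_mat (mat_adjoint (W * F) * A * (W * F)) = e # es"
    unfolding FAF using diag diag_four_block_mat[OF A1, of "U' * A3 * U" m] U U' A3
      diagA1 by (simp add: U'_def)
  show ?case using 1 2 F W by (intro bexI[of _ "W * F"]) auto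
qed

section \<open>Eigenvalue sums against column norms\<close>

theorem sum_cmod_eigenvalues_le_col_norms:
  fixes A :: "complex mat"
  assumes A: "A \<in> carrier_mat n n" and cp: "char_poly A = (\<Prod>e\<leftarrow>es. [:- e, 1:])"
  shows "(\<Sum>e\<leftarrow>es. cmod (e - c)) \<le> (\<Sum>j<n. sqrt (\<Sum>i<n. (cmod ((A - c \<cdot>\<^sub>m 1\<^sub>m n) $$ (i, j)))\<^sup>2))"
proof -
  obtain U where U: "U \<in> carrier_mat n n" and UU: "mat_adjoint U * U = 1\<^sub>m n"
    and es: "es = diag_mat (mat_adjoint U * A * U)"
    using unitary_schur[OF A cp] by blast
  define V where "V = mat_adjoint U"
  define M where "M = A - c \<cdot>\<^sub>m 1\<^sub>m n"
  have V: "V \<in> carrier_mat n n" and M: "M \<in> carrier_mat n n" using U A by (auto simp: V_def M_def)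
  have VM: "V * M \<in> carrier_mat n n" using V M by simp
  have VU: "V * U = 1\<^sub>m n" using UU by (simp add: V_def)
  have UV: "U * V = 1\<^sub>m n" by (rule mat_mult_left_right_inverse[OF V U VU])
  \<comment> \<open>Conjugation by a unitary matrix fixes scalar matrices, so the diagonal of
    \<open>V * M * U\<close> lists the shifted eigenvalues \<open>e - c\<close>.\<close>
  have "V * M * U = (V * A - V * (c \<cdot>\<^sub>m 1\<^sub>m n)) * U"
    unfolding M_def using A V by (subst mult_minus_distrib_mat[of _ n n]) auto
  also have "\<dots> = V * A * U - V * (c \<cdot>\<^sub>m 1\<^sub>m n) * U"
    using A V U by (subst minus_mult_distrib_mat[of _ n n]) auto
  also have "V * (c \<cdot>\<^sub>m 1\<^sub>m n) * U = c \<cdot>\<^sub>m 1\<^sub>m n"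
    using V U mult_smult_distrib[of V n n "1\<^sub>m n" n c] mult_smult_assoc_mat[of V n n U n c]
    by (simp add: VU)
  finally have VMU: "V * M * U = V * A * U - c \<cdot>\<^sub>m 1\<^sub>m n" .
  \<comment> \<open>Row j of \<open>U\<close> is, up to conjugation, column j of \<open>V\<close>,
    and \<open>V\<close> has unit columns because \<open>U * V = 1\<^sub>m n\<close>.\<close>
  have row: "(\<Sum>k<n. (cmod (U $$ (j, k)))\<^sup>2) = 1" if "j < n" for j
  proof -
    have "complex_of_real (\<Sum>k<n. (cmod (V $$ (k, j)))\<^sup>2) = (mat_adjoint V * V) $$ (j, j)"
      using mat_adjoint_mult_self_diag[OF V that] by simp
    also have "\<dots> = 1" using UV that by (simp add: V_def)
    finally have "(\<Sum>k<n. (cmod (V $$ (k, j)))\<^sup>2) = 1" by (simp only: of_real_eq_1_iff)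
    then show ?thesis using U that by (simp add: V_def)
  qed
  \<comment> \<open>Multiplying by the unitary \<open>V\<close> from the left leaves the Gram matrix
    of \<open>M\<close>, and with it all column norms, unchanged.\<close>
  have col: "(\<Sum>k<n. (cmod ((V * M) $$ (k, j)))\<^sup>2) = (\<Sum>i<n. (cmod (M $$ (i, j)))\<^sup>2)"
    if "j < n" for j
  proof -
    have "mat_adjoint (V * M) * (V * M) = mat_adjoint M * (U * V) * M"
      using mat_adjoint_mult[OF V M] U V M
      by (simp add: V_def assoc_mult_mat[of _ n n _ n _ n])
    also have "\<dots> = mat_adjoint M * M" using M by (simp add: UV)
    finally have "complex_of_real (\<Sum>k<n. (cmod ((V * M) $$ (k, j)))\<^sup>2) =
        complex_of_real (\<Sum>i<n. (cmod (M $$ (i, j)))\<^sup>2)"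
      by (simp only: mat_adjoint_mult_self_diag[OF M that, symmetric]
          mat_adjoint_mult_self_diag[OF VM that, symmetric])
    then show ?thesis by (simp only: of_real_eq_iff)
  qed
  have "(\<Sum>e\<leftarrow>es. cmod (e - c)) = (\<Sum>k<n. cmod ((V * M * U) $$ (k, k)))"
    unfolding es diag_mat_def VMU using U V A
    by (simp add: V_def sum_list_distinct_conv_sum_set o_def atLeast0LessThan)
  also have "\<dots> \<le> (\<Sum>k<n. \<Sum>j<n. cmod (U $$ (j, k)) * cmod ((V * M) $$ (k, j)))"
  proof (rule sum_mono)
    fix k assume "k \<in> {..<n}"
    then have k: "k < n" by simp
    have "(V * M * U) $$ (k, k) = (\<Sum>j<n. (V * M) $$ (k, j) * U $$ (j, k))"
      using k V M U by (subst index_mult_mat) (auto simp: scalar_prod_def atLeast0LessThan intro!: sum.cong)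
    also have "cmod \<dots> \<le> (\<Sum>j<n. cmod ((V * M) $$ (k, j) * U $$ (j, k)))" by (rule norm_sum)
    finally show "cmod ((V * M * U) $$ (k, k)) \<le> (\<Sum>j<n. cmod (U $$ (j, k)) * cmod ((V * M) $$ (k, j)))"
      by (simp add: norm_mult mult.commute)
  qed
  \<comment> \<open>After the exchange, the inner sum for fixed j pairs row j of \<open>U\<close>
    with column j of \<open>V * M\<close>, the two vectors whose norms are known.\<close>
  also have "\<dots> = (\<Sum>j<n. \<Sum>k<n. cmod (U $$ (j, k)) * cmod ((V * M) $$ (k, j)))"
    by (rule sum.swap)
  also have "\<dots> \<le> (\<Sum>j<n. sqrt (\<Sum>i<n. (cmod (M $$ (i, j)))\<^sup>2))"
  proof (rule sum_mono)
    fix j assume "j \<in> {..<n}"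
    then have j: "j < n" by simp
    have "(\<Sum>k<n. cmod (U $$ (j, k)) * cmod ((V * M) $$ (k, j))) \<le>
        L2_set (\<lambda>k. cmod (U $$ (j, k))) {..<n} * L2_set (\<lambda>k. cmod ((V * M) $$ (k, j))) {..<n}"
      using L2_set_mult_ineq[of "\<lambda>k. cmod (U $$ (j, k))" "\<lambda>k. cmod ((V * M) $$ (k, j))" "{..<n}"] by simp
    then show "(\<Sum>k<n. cmod (U $$ (j, k)) * cmod ((V * M) $$ (k, j))) \<le>
        sqrt (\<Sum>i<n. (cmod (M $$ (i, j)))\<^sup>2)"
      by (simp only: L2_set_def row[OF j] col[OF j] real_sqrt_one mult_1)
  qed
  finally show ?thesis by (simp add: M_def)
qed

section \<open>Algebraic multiplicities and lists of roots\<close>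

text \<open>The order of a root is additive over nonzero products, and a linear factor contributes 1
  exactly at its own root.\<close>

lemma order_prod_linear_factors:
  fixes es :: "'a :: field list"
  shows "Polynomial.order x (\<Prod>e\<leftarrow>es. [:- e, 1:]) = count_list es x"
proof (induction es)
  case (Cons e es)
  have "(\<Prod>e\<leftarrow>es. [:- e, 1:]) \<noteq> 0" by (auto simp: prod_list_zero_iff)
  then have "Polynomial.order x (\<Prod>e\<leftarrow>e # es. [:- e, 1:]) =
      Polynomial.order x [:- e, 1:] + Polynomial.order x (\<Prod>e\<leftarrow>es. [:- e, 1:])"
    by (simp add: order_mult del: mult_pCons_left)
  moreover have "Polynomial.order x [:- e, 1:] = (if e = x then 1 else 0)"
    using order_power_n_n[of x 1] by (auto simp: order_0I)
  ultimately show ?case using Cons.IH by simp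
qed (simp add: order_0I)

lemma sum_list_eq_sum_real_count:
  fixes f :: "'a \<Rightarrow> real"
  shows "(\<Sum>x\<leftarrow>xs. f x) = (\<Sum>x\<in>set xs. real (count_list xs x) * f x)"
proof -
  \<comment> \<open>The index set is generalised to a fixed finite superset \<open>S\<close>, so
    that it does not change when the induction adds an element to the list.\<close>
  have "(\<Sum>x\<leftarrow>xs. f x) = (\<Sum>x\<in>S. real (count_list xs x) * f x)"
    if "finite S" "set xs \<subseteq> S" for S
    using that
  proof (induction xs)
    case (Cons a xs)
    have "(\<Sum>x\<in>S. real (count_list (a # xs) x) * f x) =
        (\<Sum>x\<in>S. real (count_list xs x) * f x + (if x = a then f a else 0))"
      by (intro sum.cong) (auto simp: algebra_simps)
    also have "\<dots> = (\<Sum>x\<leftarrow>a # xs. f x)" using Cons by (simp add: sum.distrib)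
    finally show ?case by simp
  qed simp
  then show ?thesis by simp
qed

text \<open>Over the complex numbers the characteristic polynomial splits, so the spectrum weighted
  by multiplicities becomes the list of its roots. The complex bound then applies, and its moduli
  are those of real entries.\<close>

theorem eigenvalue_deviation_le_col_norms:
  assumes A: "A \<in> carrier_mat n n"
  shows "eigenvalue_deviation A c \<le> (\<Sum>j<n. sqrt (\<Sum>i<n. ((A - c \<cdot>\<^sub>m 1\<^sub>m n) $$ (i, j))\<^sup>2))"
proof -
  define B where "B = map_mat complex_of_real A"
  have B: "B \<in> carrier_mat n n" using A by (simp add: B_def)
  obtain es where cp: "char_poly B = (\<Prod>e\<leftarrow>es. [:- e, 1:])"
    using char_poly_factorized[OF B] by blast
  have "spectrum B = set es"
    by (auto simp: spectrum_def eigenvalue_root_char_poly[OF B] cp poly_prod_list prod_list_zero_iff)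
  then have "eigenvalue_deviation A c = (\<Sum>e\<leftarrow>es. cmod (e - complex_of_real c))"
    by (simp add: eigenvalue_deviation_def flip: B_def)
       (simp add: cp order_prod_linear_factors sum_list_eq_sum_real_count)
  also have "\<dots> \<le> (\<Sum>j<n. sqrt (\<Sum>i<n. (cmod ((B - complex_of_real c \<cdot>\<^sub>m 1\<^sub>m n) $$ (i, j)))\<^sup>2))"
    by (rule sum_cmod_eigenvalues_le_col_norms[OF B cp])
  also have "\<dots> = (\<Sum>j<n. sqrt (\<Sum>i<n. ((A - c \<cdot>\<^sub>m 1\<^sub>m n) $$ (i, j))\<^sup>2))"
  proof (intro sum.cong refl arg_cong[where f = sqrt])
    fix i j assume "i \<in> {..<n}" "j \<in> {..<n}"
    then have "(B - complex_of_real c \<cdot>\<^sub>m 1\<^sub>m n) $$ (i, j) =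
        complex_of_real ((A - c \<cdot>\<^sub>m 1\<^sub>m n) $$ (i, j))"
      using A by (auto simp: B_def)
    then show "(cmod ((B - complex_of_real c \<cdot>\<^sub>m 1\<^sub>m n) $$ (i, j)))\<^sup>2 = ((A - c \<cdot>\<^sub>m 1\<^sub>m n) $$ (i, j))\<^sup>2"
      by simp
  qed
  finally show ?thesis .
qed

section \<open>Common neighbours in regular graphs\<close>

lemma (in graph) nbhd_sym: "w \<in> nbhd G v \<longleftrightarrow> v \<in> nbhd G w"
  unfolding nbhd_def mem_Collect_eq by (metis arcs_ends_symmetric sym_arcs)

lemma (in graph) nbhd_subset_verts: "nbhd G v \<subseteq> verts G"
  by (auto simp: nbhd_def dest: adj_in_verts)

text \<open>Double counting: with \<open>N\<close> the neighbourhood of the i-th vertex, the sizes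
  of \<open>N \<inter> nbhd G v\<close> over all vertices \<open>v\<close> count the pairs of a
  \<open>w\<close> in \<open>N\<close> and a neighbour \<open>v\<close> of \<open>w\<close>, which
  are \<open>r * r\<close>. The term for the i-th vertex itself is \<open>r\<close>, and
  \<open>CN\<close> replaces it by 0.\<close>

lemma CN_row_sum:
  assumes reg: "regular_graph r G" and vs: "distinct vs" "set vs = verts G" and i: "i < length vs"
  shows "(\<Sum>j<length vs. CN G vs $$ (i, j)) = real r * (real r - 1)"
proof -
  interpret graph G using reg by (simp add: regular_graph_def)
  have deg: "card (nbhd G v) = r" if "v \<in> verts G" for v
    using reg that by (simp add: regular_graph_def flip: out_degree_eq_card_nbhd)
  define N where "N = nbhd G (vs ! i)"
  have vi: "vs ! i \<in> verts G" using i vs(2) nth_mem by blast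
  have NV: "N \<subseteq> verts G" unfolding N_def by (rule nbhd_subset_verts)
  then have fN: "finite N" by (rule finite_subset) simp
  have "(\<Sum>j<length vs. card (N \<inter> nbhd G (vs ! j))) = (\<Sum>v\<in>verts G. card (N \<inter> nbhd G v))"
    using vs by (intro sum.reindex_bij_betw bij_betw_nth) auto
  also have "\<dots> = (\<Sum>v\<in>verts G. \<Sum>w\<in>N. if w \<in> nbhd G v then 1 else 0)"
    using fN by (simp add: sum.If_cases)
  also have "\<dots> = (\<Sum>w\<in>N. \<Sum>v\<in>verts G. if w \<in> nbhd G v then 1 else 0)" by (rule sum.swap)
  also have "\<dots> = (\<Sum>w\<in>N. card (nbhd G w))"
  proof (rule sum.cong)
    fix w
    have "verts G \<inter> {v. w \<in> nbhd G v} = nbhd G w" using nbhd_sym nbhd_subset_verts by blast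
    then show "(\<Sum>v\<in>verts G. if w \<in> nbhd G v then 1 else 0) = card (nbhd G w)"
      by (simp add: sum.If_cases)
  qed simp
  also have "\<dots> = (\<Sum>w\<in>N. r)" using NV by (intro sum.cong) (auto simp: deg)
  finally have all: "(\<Sum>j<length vs. card (N \<inter> nbhd G (vs ! j))) = r * r"
    using deg[OF vi] by (simp add: N_def)
  have "(\<Sum>j<length vs. CN G vs $$ (i, j)) =
      (\<Sum>j<length vs. real (card (N \<inter> nbhd G (vs ! j))) - (if j = i then real r else 0))"
    using i deg[OF vi] by (intro sum.cong) (auto simp: CN_def N_def)
  also have "\<dots> = real (\<Sum>j<length vs. card (N \<inter> nbhd G (vs ! j))) - real r"
    using i by (simp add: sum_subtractf)
  finally show ?thesis by (simp add: all algebra_simps)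
qed

theorem theorem5p9:
  fixes G :: "('a, 'b) pre_digraph" and vs :: "'a list" and r :: nat
  assumes "regular_graph r G"
    and "distinct vs" and "set vs = verts G"
  shows "LE_CN G vs \<le> (\<Sum>i<length vs. sqrt (\<Sum>k<length vs.
             (real (card (nbhd G (vs ! i) \<inter> nbhd G (vs ! k))))\<^sup>2)) \<and>
         LE_CN_plus G vs \<le> (\<Sum>i<length vs. sqrt (\<Sum>k<length vs.
             (real (card (nbhd G (vs ! i) \<inter> nbhd G (vs ! k))))\<^sup>2))"
proof -
  define n where "n = length vs"
  define d where "d = real r * (real r - 1)"
  define c where "c = mat_trace (CNRS G vs) / real n"
  have CN: "CN G vs \<in> carrier_mat n n" by (simp add: CN_def n_def)
  have CNRS: "CNRS G vs = d \<cdot>\<^sub>m 1\<^sub>m n"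
    by (rule eq_matI) (auto simp: CNRS_def mat_diag_def n_def d_def CN_row_sum[OF assms])
  \<comment> \<open>Without vertices \<open>c\<close> is 0 / 0, hence 0, and may differ from
    \<open>d\<close>; the bound then ranges over no indices, so the guarded equality
    suffices.\<close>
  have c: "c = d" if "n \<noteq> 0" using that by (simp add: c_def CNRS mat_trace_def)
  \<comment> \<open>\<open>CNL\<close> and \<open>CNSL\<close> differ from
    \<open>d \<cdot>\<^sub>m 1\<^sub>m n\<close> by \<open>CN\<close> up to sign, and the column
    norms see only absolute values, so one argument covers both energies.\<close>
  have bound: "eigenvalue_deviation A c \<le> (\<Sum>i<n. sqrt (\<Sum>k<n.
      (real (card (nbhd G (vs ! i) \<inter> nbhd G (vs ! k))))\<^sup>2))"
    if A: "A \<in> carrier_mat n n"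
      and AC: "\<And>i j. i < n \<Longrightarrow> j < n \<Longrightarrow> \<bar>(A - d \<cdot>\<^sub>m 1\<^sub>m n) $$ (i, j)\<bar> = \<bar>CN G vs $$ (i, j)\<bar>" for A
  proof -
    \<comment> \<open>The indices are swapped since the general bound sums over columns;
      intersections are symmetric, so column i matches the i-th summand of the claim. On the
      diagonal the left-hand side is 0.\<close>
    have "((A - c \<cdot>\<^sub>m 1\<^sub>m n) $$ (k, i))\<^sup>2 \<le> (real (card (nbhd G (vs ! i) \<inter> nbhd G (vs ! k))))\<^sup>2"
      if ik: "i < n" "k < n" for i k
    proof -
      have "\<bar>(A - c \<cdot>\<^sub>m 1\<^sub>m n) $$ (k, i)\<bar> = \<bar>CN G vs $$ (k, i)\<bar>"
        using AC[OF ik(2,1)] c ik by simp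
      also have "\<dots> \<le> \<bar>real (card (nbhd G (vs ! i) \<inter> nbhd G (vs ! k)))\<bar>"
        using ik by (simp add: CN_def n_def Int_commute)
      finally show ?thesis by (simp only: abs_le_square_iff)
    qed
    then show ?thesis
      by (intro order_trans[OF eigenvalue_deviation_le_col_norms[OF A]] sum_mono real_sqrt_le_mono) auto
  qed
  have "LE_CN G vs = eigenvalue_deviation (CNL G vs) c"
    and "LE_CN_plus G vs = eigenvalue_deviation (CNSL G vs) c"
    by (simp_all add: LE_CN_def LE_CN_plus_def c_def n_def)
  moreover have "eigenvalue_deviation (CNL G vs) c \<le> (\<Sum>i<n. sqrt (\<Sum>k<n.
      (real (card (nbhd G (vs ! i) \<inter> nbhd G (vs ! k))))\<^sup>2))"
    by (rule bound) (use CN in \<open>auto simp: CNL_def CNRS\<close>)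
  moreover have "eigenvalue_deviation (CNSL G vs) c \<le> (\<Sum>i<n. sqrt (\<Sum>k<n.
      (real (card (nbhd G (vs ! i) \<inter> nbhd G (vs ! k))))\<^sup>2))"
    by (rule bound) (use CN in \<open>auto simp: CNSL_def CNRS\<close>)
  ultimately show ?thesis by (simp add: n_def)
qed

end
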